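(* Let $(\overline{x},\overline{\lambda})\in\mathbb{R}^n\times\mathbb{R}^m$. (i) Assume that $(\overline{x},\overline{\lambda})$ is a KKT point of $L$. Then $\overline{x}$ is a KKT point of $(P_i)$, and so $\overline{x}\in X_i$, $\overline{\lambda}\in Y_{\mathrm{col}}^{i}$, and $q_0(\overline{x})=L(\overline{x},\overline{\lambda})=D(\overline{\lambda})$; moreover, if $\overline{\lambda}\in Y_{\mathrm{col}}^{i+}$ then $$q_0(\overline{x})=\inf_{x\in X_i}q_0(x)=L(\overline{x},\overline{\lambda})=\sup_{\lambda\in Y_{\mathrm{col}}^{i+}}D(\lambda)=D(\overline{\lambda}).$$ (ii) Assume that $(\overline{x},\overline{\lambda})$ is a KKT point of $L$ with $\overline{\lambda}\in Y_0$. Then $\overline{x}=A(\overline{\lambda})^{-1}b(\overline{\lambda})$ and $\overline{\lambda}$ is a KKT point of $D$; moreover, $\overline{x}$ is the unique global minimizer of $q_0$ on $X_i$ provided $\overline{\lambda}\in Y^{i+}$. Conversely, assume that $\overline{\lambda}\in Y_0$ is a KKT point of $D$. Then $(\overline{x},\overline{\lambda})$ is a KKT point of $L$, where $\overline{x}:=A(\overline{\lambda})^{-1}b(\overline{\lambda})$. (iii) Assume that $\overline{\lambda}\in Y^{i+}$. Then $$D(\overline{\lambda})=\sup_{\lambda\in Y_{\mathrm{col}}^{i+}}D(\lambda)\iff D(\overline{\lambda})=\sup_{\lambda\in Y^{i+}}D(\lambda)\iff\overline{\lambda}\text{ is a KKT point of }D.$$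
   Context: For $k\in\{0,1,\dots,m\}$ let $q_k:\mathbb{R}^n\to\mathbb{R}$, $q_k(x):=\tfrac12\langle x,A_kx\rangle-\langle b_k,x\rangle+c_k$, where $A_k$ is a given real symmetric $n\times n$ matrix, $b_k\in\mathbb{R}^n$, $c_k\in\mathbb{R}$. Let $X_i:=\{x\in\mathbb{R}^n\mid q_j(x)\le0\ \forall j\in\{1,\dots,m\}\}$ (the letter $i$ stands for "inequality" and is not an index). Problem $(P_i)$ is: minimize $q_0(x)$ subject to $x\in X_i$. Let $\mathbb{R}^m_+$ be the set of vectors with nonnegative components and $\mathbb{R}^m_-:=-\mathbb{R}^m_+$. For $\lambda\in\mathbb{R}^m$, with $\lambda_0:=1$, put $A(\lambda):=\sum_{k=0}^m\lambda_kA_k$, $b(\lambda):=\sum_{k=0}^m\lambda_kb_k$, $c(\lambda):=\sum_{k=0}^m\lambda_kc_k$. The Lagrangian is $L:\mathbb{R}^n\times\mathbb{R}^m\to\mathbb{R}$, $L(x,\lambda):=q_0(x)+\sum_{j=1}^m\lambda_jq_j(x)=\tfrac12\langle x,A(\lambda)x\rangle-\langle x,b(\lambda)\rangle+c(\lambda)$. Sets ($\succ0$, $\succeq0$ mean positive definite, positive semidefinite): $Y_0:=\{\lambda\in\mathbb{R}^m\mid\det A(\lambda)\ne0\}$, $Y_{\mathrm{col}}:=\{\lambda\in\mathbb{R}^m\mid b(\lambda)\in\operatorname{Im}A(\lambda)\}$, $Y^{i+}:=\{\lambda\in\mathbb{R}^m_+\mid A(\lambda)\succ0\}$, $Y_{\mathrm{col}}^{i}:=\mathbb{R}^m_+\cap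 Y_{\mathrm{col}}$, $Y_{\mathrm{col}}^{i+}:=\{\lambda\in Y_{\mathrm{col}}^{i}\mid A(\lambda)\succeq0\}$. The dual function is $D:Y_{\mathrm{col}}\to\mathbb{R}$, $D(\lambda):=L(x,\lambda)$ for any $x$ with $A(\lambda)x=b(\lambda)$ (the value does not depend on the choice of such $x$). On the open set $Y_0\subset Y_{\mathrm{col}}$ one has $D(\lambda)=-\tfrac12\langle b(\lambda),A(\lambda)^{-1}b(\lambda)\rangle+c(\lambda)$, which is smooth. $(\overline{x},\overline{\lambda})$ is a KKT point of $L$ if $\nabla_xL(\overline{x},\overline{\lambda})=0$, $\overline{\lambda}\in\mathbb{R}^m_+$, $\nabla_\lambda L(\overline{x},\overline{\lambda})\in\mathbb{R}^m_-$ and $\langle\overline{\lambda},\nabla_\lambda L(\overline{x},\overline{\lambda})\rangle=0$. A point $\overline{x}$ is a KKT point of $(P_i)$ if there is $\overline{\lambda}\in\mathbb{R}^m$ such that $(\overline{x},\overline{\lambda})$ is a KKT point of $L$. A point $\overline{\lambda}\in Y_0$ is a KKT point of $D$ if $\overline{\lambda}\in\mathbb{R}^m_+$, $\nabla D(\overline{\lambda})\in\mathbb{R}^m_-$ and $\langle\overline{\lambda},\nabla D(\overline{\lambda})\rangle=0$. *)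

theory Defs
  imports "HOL-Analysis.Analysis"
begin

text \<open>
  The index set \<open>{0, 1, \<dots>, m}\<close> of the problem data is rendered as the type \<open>'m option\<close>:
  \<open>None\<close> is the index \<open>0\<close> (objective), \<open>Some j\<close> the index of the \<open>j\<close>-th constraint.
  The data are families \<open>A\<close>, \<open>b\<close>, \<open>c\<close> over this type; the symmetry of the
  matrices \<open>A k\<close> is not built into the definitions.
\<close>

definition quad ::
  "('m option \<Rightarrow> real^'n^'n) \<Rightarrow> ('m option \<Rightarrow> real^'n) \<Rightarrow> ('m option \<Rightarrow> real)
    \<Rightarrow> 'm option \<Rightarrow> real^'n \<Rightarrow> real" where
  "quad A b c k x = 1/2 * (x \<bullet> (A k *v x)) - b k \<bullet> x + c k"

definition feasible ::
  "('m option \<Rightarrow> real^'n^'n) \<Rightarrow> ('m option \<Rightarrow> real^'n) \<Rightarrow> ('m option \<Rightarrow> real)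
    \<Rightarrow> (real^'n) set" where
  "feasible A b c = {x. \<forall>j. quad A b c (Some j) x \<le> 0}"

definition nonneg_orthant :: "(real^'m) set" where
  "nonneg_orthant = {l. \<forall>j. 0 \<le> l $ j}"

definition nonpos_orthant :: "(real^'m) set" where
  "nonpos_orthant = uminus ` nonneg_orthant"

text \<open>The multiplier vector extended by the convention that its component of index \<open>0\<close> is 1.\<close>

definition mult_ext :: "real^'m \<Rightarrow> 'm option \<Rightarrow> real" where
  "mult_ext l k = (case k of None \<Rightarrow> 1 | Some j \<Rightarrow> l $ j)"

definition A_of :: "('m::finite option \<Rightarrow> real^'n^'n) \<Rightarrow> real^'m \<Rightarrow> real^'n^'n" where
  "A_of A l = (\<Sum>k\<in>UNIV. mult_ext l k *\<^sub>R A k)"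

definition b_of :: "('m::finite option \<Rightarrow> real^'n) \<Rightarrow> real^'m \<Rightarrow> real^'n" where
  "b_of b l = (\<Sum>k\<in>UNIV. mult_ext l k *\<^sub>R b k)"

definition c_of :: "('m::finite option \<Rightarrow> real) \<Rightarrow> real^'m \<Rightarrow> real" where
  "c_of c l = (\<Sum>k\<in>UNIV. mult_ext l k * c k)"

definition Lagr ::
  "('m::finite option \<Rightarrow> real^'n^'n) \<Rightarrow> ('m option \<Rightarrow> real^'n) \<Rightarrow> ('m option \<Rightarrow> real)
    \<Rightarrow> real^'n \<Rightarrow> real^'m \<Rightarrow> real" where
  "Lagr A b c x l = quad A b c None x + (\<Sum>j\<in>UNIV. l $ j * quad A b c (Some j) x)"

definition pos_def :: "real^'n^'n \<Rightarrow> bool" where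
  "pos_def M \<longleftrightarrow> transpose M = M \<and> (\<forall>x. x \<noteq> 0 \<longrightarrow> 0 < x \<bullet> (M *v x))"

definition pos_semidef :: "real^'n^'n \<Rightarrow> bool" where
  "pos_semidef M \<longleftrightarrow> transpose M = M \<and> (\<forall>x. 0 \<le> x \<bullet> (M *v x))"

definition Y0 :: "('m::finite option \<Rightarrow> real^'n^'n) \<Rightarrow> (real^'m) set" where
  "Y0 A = {l. det (A_of A l) \<noteq> 0}"

definition Ycol ::
  "('m::finite option \<Rightarrow> real^'n^'n) \<Rightarrow> ('m option \<Rightarrow> real^'n) \<Rightarrow> (real^'m) set" where
  "Ycol A b = {l. b_of b l \<in> range (\<lambda>x. A_of A l *v x)}"

definition Yi_plus :: "('m::finite option \<Rightarrow> real^'n^'n) \<Rightarrow> (real^'m) set" where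
  "Yi_plus A = {l \<in> nonneg_orthant. pos_def (A_of A l)}"

definition Ycol_i ::
  "('m::finite option \<Rightarrow> real^'n^'n) \<Rightarrow> ('m option \<Rightarrow> real^'n) \<Rightarrow> (real^'m) set" where
  "Ycol_i A b = nonneg_orthant \<inter> Ycol A b"

definition Ycol_i_plus ::
  "('m::finite option \<Rightarrow> real^'n^'n) \<Rightarrow> ('m option \<Rightarrow> real^'n) \<Rightarrow> (real^'m) set" where
  "Ycol_i_plus A b = {l \<in> Ycol_i A b. pos_semidef (A_of A l)}"

text \<open>
  The dual function, a total function here, is meaningful only on \<open>Ycol A b\<close>. For symmetric data
  its value there does not depend on the choice of the solution, see \<open>dual_eq\<close> below.
\<close>

definition dual ::
  "('m::finite option \<Rightarrow> real^'n^'n) \<Rightarrow> ('m option \<Rightarrow> real^'n) \<Rightarrow> ('m option \<Rightarrow> real)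
    \<Rightarrow> real^'m \<Rightarrow> real" where
  "dual A b c l = Lagr A b c (SOME x. A_of A l *v x = b_of b l) l"

definition KKT_L ::
  "('m::finite option \<Rightarrow> real^'n^'n) \<Rightarrow> ('m option \<Rightarrow> real^'n) \<Rightarrow> ('m option \<Rightarrow> real)
    \<Rightarrow> real^'n \<Rightarrow> real^'m \<Rightarrow> bool" where
  "KKT_L A b c x l \<longleftrightarrow>
     GDERIV (\<lambda>y. Lagr A b c y l) x :> 0 \<and>
     l \<in> nonneg_orthant \<and>
     (\<exists>g. GDERIV (\<lambda>u. Lagr A b c x u) l :> g \<and> g \<in> nonpos_orthant \<and> l \<bullet> g = 0)"

definition KKT_P ::
  "('m::finite option \<Rightarrow> real^'n^'n) \<Rightarrow> ('m option \<Rightarrow> real^'n) \<Rightarrow> ('m option \<Rightarrow> real)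
    \<Rightarrow> real^'n \<Rightarrow> bool" where
  "KKT_P A b c x \<longleftrightarrow> (\<exists>l. KKT_L A b c x l)"

definition KKT_D ::
  "('m::finite option \<Rightarrow> real^'n^'n) \<Rightarrow> ('m option \<Rightarrow> real^'n) \<Rightarrow> ('m option \<Rightarrow> real)
    \<Rightarrow> real^'m \<Rightarrow> bool" where
  "KKT_D A b c l \<longleftrightarrow>
     l \<in> Y0 A \<and>
     l \<in> nonneg_orthant \<and>
     (\<exists>g. GDERIV (dual A b c) l :> g \<and> g \<in> nonpos_orthant \<and> l \<bullet> g = 0)"

lemma sum_option:
  fixes f :: "'m::finite option \<Rightarrow> 'a::comm_monoid_add"
  shows "(\<Sum>k\<in>UNIV. f k) = f None + (\<Sum>j\<in>UNIV. f (Some j))"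
  by (simp add: UNIV_option_conv sum.reindex)

lemma A_of_mult: "A_of A l *v x = (\<Sum>k\<in>UNIV. mult_ext l k *\<^sub>R (A k *v x))"
proof -
  have "A_of A l *v x = (\<Sum>k\<in>UNIV. (mult_ext l k *\<^sub>R A k) *v x)"
    unfolding A_of_def
    using linear_sum[of "\<lambda>M. M *v x" "\<lambda>k. mult_ext l k *\<^sub>R A k" UNIV]
    by (simp add: linear_iff matrix_vector_mult_add_rdistrib scaleR_matrix_vector_assoc)
  then show ?thesis
    by (simp add: scaleR_matrix_vector_assoc)
qed

lemma Lagr_eq:
  "Lagr A b c x l = 1/2 * (x \<bullet> (A_of A l *v x)) - x \<bullet> b_of b l + c_of c l"
proof -
  have "Lagr A b c x l = (\<Sum>k\<in>UNIV. mult_ext l k * quad A b c k x)"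
    by (simp add: Lagr_def sum_option mult_ext_def)
  also have "\<dots> = 1/2 * (x \<bullet> (A_of A l *v x)) - x \<bullet> b_of b l + c_of c l"
    unfolding A_of_mult b_of_def c_of_def quad_def
    by (simp add: inner_sum_right sum_distrib_left sum.distrib sum_subtractf
        algebra_simps inner_commute)
  finally show ?thesis .
qed

lemma transpose_A_of:
  assumes "\<And>k. transpose (A k) = A k"
  shows "transpose (A_of A l) = A_of A l"
  using assms by (simp add: A_of_def transpose_def vec_eq_iff)

lemma dual_eq:
  assumes sym: "\<And>k. transpose (A k) = A k"
    and x: "A_of A l *v x = b_of b l"
  shows "dual A b c l = Lagr A b c x l"
proof -
  define z where "z = (SOME x. A_of A l *v x = b_of b l)"
  have z: "A_of A l *v z = b_of b l"
    unfolding z_def by (rule someI[where P = "\<lambda>x. A_of A l *v x = b_of b l", OF x])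
  have "z \<bullet> b_of b l = x \<bullet> b_of b l"
    using dot_lmul_matrix[of z "A_of A l" x] transpose_A_of[of A l, OF sym] x z
    by (metis inner_commute transpose_matrix_vector)
  then show ?thesis
    using x z by (simp add: dual_def Lagr_eq flip: z_def)
qed

lemma dual_eq_inverse:
  assumes sym: "\<And>k. transpose (A k) = A k"
    and l: "l \<in> Y0 A"
  shows "dual A b c l = - (1/2) * (b_of b l \<bullet> (matrix_inv (A_of A l) *v b_of b l)) + c_of c l"
proof -
  have inv: "invertible (A_of A l)"
    using l by (simp add: Y0_def invertible_det_nz)
  then have "A_of A l ** matrix_inv (A_of A l) = mat 1"
    unfolding invertible_def matrix_inv_def by (rule someI2_ex) simp
  then have "A_of A l *v (matrix_inv (A_of A l) *v b_of b l) = b_of b l"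
    by (simp add: matrix_vector_mul_assoc)
  with dual_eq[OF sym this, of c] show ?thesis
    by (simp add: Lagr_eq inner_commute)
qed

end

theory Submission
  imports Defs
begin

text \<open>
  If \<open>A(u) z = b(u)\<close>, then completing the square gives
  \<open>L(y,u) = D(u) + 1/2 \<langle>y - z, A(u) (y - z)\<rangle>\<close>. For \<open>A(u) \<succeq> 0\<close> this is weak duality, and for
  \<open>A(u) \<succ> 0\<close> it gives uniqueness of the minimizer. Read for fixed \<open>y = x\<close> with \<open>A(l) x = b(l)\<close> and
  variable \<open>u\<close> near \<open>l \<in> Y\<^sub>0\<close>, it says that \<open>D\<close> differs from the affine function \<open>L(x,\<cdot>)\<close> by
  \<open>O(\<parallel>u - l\<parallel>\<^sup>2)\<close>, so that \<open>\<nabla>D(l) = (q\<^sub>1(x), \<dots>, q\<^sub>m(x))\<close>. Hence the KKT conditions of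
  \<open>D\<close> and \<open>L\<close> agree. Since \<open>A(u) \<succ> 0\<close> is an open condition, a maximizer of \<open>D\<close> on \<open>Y\<^sup>i\<^sup>+\<close> satisfies the
  first-order conditions along the coordinate directions and along \<open>\<plusminus>l\<close>, which are the KKT conditions.
\<close>

section \<open>Uniqueness of gradients; positive definite matrices\<close>

lemma GDERIV_unique:
  assumes "GDERIV f x :> g" and "GDERIV f x :> h"
  shows "g = h"
proof -
  have "(\<lambda>v. v \<bullet> g) = (\<lambda>v. v \<bullet> h)"
    using assms unfolding gderiv_def by (rule has_derivative_unique)
  \<comment> \<open>Both gradients induce the same functional, which is tested on their own
    difference.\<close>
  then have "(g - h) \<bullet> g = (g - h) \<bullet> h"
    by metis
  then have "(g - h) \<bullet> (g - h) = 0"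
    by (simp only: inner_diff_right diff_self)
  then show ?thesis by simp
qed

lemma symmetric_matrix_inner_swap:
  fixes M :: "real^'n^'n"
  assumes "transpose M = M"
  shows "(M *v x) \<bullet> y = x \<bullet> (M *v y)"
  using dot_lmul_matrix[of x M y] assms by (metis transpose_matrix_vector)

lemma pos_def_imp_pos_semidef:
  assumes "pos_def M"
  shows "pos_semidef M"
proof -
  have "0 \<le> x \<bullet> (M *v x)" for x
    using assms by (cases "x = 0") (auto simp: pos_def_def less_imp_le)
  then show ?thesis
    using assms by (simp add: pos_def_def pos_semidef_def)
qed

lemma pos_def_det_nonzero:
  fixes M :: "real^'n^'n"
  assumes "pos_def M"
  shows "det M \<noteq> 0"
proof -
  have "x = 0" if "M *v x = 0" for x
    using assms that unfolding pos_def_def by force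
  then have "\<exists>B. B ** M = mat 1"
    by (simp add: matrix_left_invertible_ker)
  then show ?thesis
    by (metis invertible_det_nz invertible_left_inverse)
qed

text \<open>The form attains its minimum on the compact unit sphere, and this minimum is positive.
  Homogeneity of degree two carries the bound to all vectors.\<close>

lemma pos_def_bounded_below:
  fixes M :: "real^'n^'n"
  assumes "pos_def M"
  obtains d where "d > 0" and "\<And>x. d * (norm x)\<^sup>2 \<le> x \<bullet> (M *v x)"
proof -
  let ?S = "sphere 0 1 :: (real^'n) set"
  have "continuous_on ?S (\<lambda>x. x \<bullet> (M *v x))"
    by (intro continuous_intros matrix_vector_mult_linear_continuous_on)
  moreover have "?S \<noteq> {}" by simp
  ultimately obtain z where z: "z \<in> ?S" and
      zmin: "\<And>y. y \<in> ?S \<Longrightarrow> z \<bullet> (M *v z) \<le> y \<bullet> (M *v y)"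
    using continuous_attains_inf[OF compact_sphere] by blast
  let ?d = "z \<bullet> (M *v z)"
  have "z \<noteq> 0" using z by auto
  then have "?d > 0"
    using assms by (simp add: pos_def_def)
  moreover have "?d * (norm x)\<^sup>2 \<le> x \<bullet> (M *v x)" for x
  proof (cases "x = 0")
    case False
    define y where "y = (1 / norm x) *\<^sub>R x"
    have x: "x = norm x *\<^sub>R y" and "y \<in> ?S"
      using False by (auto simp: y_def)
    have "x \<bullet> (M *v x) = (norm x)\<^sup>2 * (y \<bullet> (M *v y))"
      \<comment> \<open>Only the two arguments of the form are rescaled; the \<open>x\<close> under
        the norm stays.\<close>
      by (subst (1 2) x) (simp add: matrix_vector_mult_scaleR power2_eq_square)
    moreover have "(norm x)\<^sup>2 * ?d \<le> (norm x)\<^sup>2 * (y \<bullet> (M *v y))"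
      using zmin[OF \<open>y \<in> ?S\<close>] by (intro mult_left_mono) auto
    ultimately show ?thesis by (simp add: mult.commute)
  qed simp
  ultimately show thesis by (rule that)
qed

section \<open>Perturbation bounds in the multiplier\<close>

lemma mult_ext_diff_le: "\<bar>mult_ext u k - mult_ext l k\<bar> \<le> norm (u - l)"
  using component_le_norm_cart[of "u - l"]
  by (cases k) (auto simp: mult_ext_def)

lemma norm_A_of_diff_le:
  "norm (A_of A u *v y - A_of A l *v y) \<le> norm (u - l) * (\<Sum>k\<in>UNIV. onorm ((*v) (A k))) * norm y"
proof -
  have "A_of A u *v y - A_of A l *v y
      = (\<Sum>k\<in>UNIV. (mult_ext u k - mult_ext l k) *\<^sub>R (A k *v y))"
    by (simp add: A_of_mult sum_subtractf scaleR_diff_left)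
  also have "norm \<dots> \<le> (\<Sum>k\<in>UNIV. norm (u - l) * (onorm ((*v) (A k)) * norm y))"
  proof (intro sum_norm_le)
    fix k
    have "norm (A k *v y) \<le> onorm ((*v) (A k)) * norm y"
      by (rule onorm) simp
    then show "norm ((mult_ext u k - mult_ext l k) *\<^sub>R (A k *v y))
        \<le> norm (u - l) * (onorm ((*v) (A k)) * norm y)"
      by (auto intro!: mult_mono mult_ext_diff_le)
  qed
  finally show ?thesis
    by (simp add: sum_distrib_left sum_distrib_right mult.assoc)
qed

text \<open>The radius does not depend on \<open>y\<close>, so lower bounds valid at
  \<open>l\<close> for all vectors survive nearby with a smaller constant. This is used both for
  invertibility and for definiteness.\<close>

lemma A_of_perturbation:
  fixes A :: "'m::finite option \<Rightarrow> real^'n^'n"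
  assumes "e > 0"
  obtains d where "d > 0"
    and "\<And>u y. dist u l < d \<Longrightarrow> norm (A_of A u *v y - A_of A l *v y) \<le> e * norm y"
proof
  define K where "K = (\<Sum>k\<in>UNIV. onorm ((*v) (A k)))"
  have K: "K \<ge> 0"
    unfolding K_def by (intro sum_nonneg onorm_pos_le) simp
  \<comment> \<open>The divisor is \<open>K + 1\<close> because \<open>K\<close> vanishes when all
    the matrices do.\<close>
  show "0 < e / (K + 1)" using assms K by simp
  fix u and y :: "real^'n"
  assume "dist u l < e / (K + 1)"
  then have "norm (u - l) * (K + 1) \<le> e"
    using K by (simp add: dist_norm field_simps)
  then have "norm (u - l) * K + norm (u - l) \<le> e"
    by (simp add: distrib_left)
  then have "norm (u - l) * K \<le> e"
    using norm_ge_zero[of "u - l"] by linarith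
  then have "norm (u - l) * K * norm y \<le> e * norm y"
    by (intro mult_right_mono) auto
  then show "norm (A_of A u *v y - A_of A l *v y) \<le> e * norm y"
    using norm_A_of_diff_le[of A u y l] by (simp add: K_def)
qed

text \<open>For fixed \<open>x\<close> the residual is affine in the multiplier and vanishes at
  \<open>l\<close>, hence it is of first order in \<open>u - l\<close>.\<close>

lemma norm_residual_le:
  assumes "A_of A l *v x = b_of b l"
  shows "norm (A_of A u *v x - b_of b u) \<le> norm (u - l) * (\<Sum>k\<in>UNIV. norm (A k *v x - b k))"
proof -
  have "A_of A u *v x - b_of b u = (A_of A u *v x - b_of b u) - (A_of A l *v x - b_of b l)"
    using assms by simp
  also have "\<dots> = (\<Sum>k\<in>UNIV. (mult_ext u k - mult_ext l k) *\<^sub>R (A k *v x - b k))"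
    by (simp add: A_of_mult b_of_def sum_subtractf scaleR_diff_left scaleR_diff_right)
  also have "norm \<dots> \<le> (\<Sum>k\<in>UNIV. norm (u - l) * norm (A k *v x - b k))"
    by (intro sum_norm_le) (auto intro!: mult_right_mono mult_ext_diff_le)
  finally show ?thesis by (simp add: sum_distrib_left)
qed

lemma Y0_solution_iff:
  assumes "l \<in> Y0 A"
  shows "A_of A l *v x = b_of b l \<longleftrightarrow> x = matrix_inv (A_of A l) *v b_of b l"
proof -
  let ?M = "A_of A l"
  have "invertible ?M"
    using assms by (simp add: Y0_def invertible_det_nz)
  then have inv: "?M ** matrix_inv ?M = mat 1 \<and> matrix_inv ?M ** ?M = mat 1"
    unfolding invertible_def matrix_inv_def by (rule someI_ex)
  then show ?thesis
    by (metis matrix_vector_mul_assoc matrix_vector_mul_lid)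
qed

text \<open>An injective linear map is bounded below, and a perturbation of at most half that bound
  leaves the other half. Besides openness of \<open>Y0\<close> this gives a bound on the inverses of
  \<open>A(u)\<close> that is uniform in \<open>u\<close>.\<close>

lemma Y0_neighbourhood:
  assumes "l \<in> Y0 A"
  obtains B d where "B > 0" "d > 0"
    "\<And>u y. dist u l < d \<Longrightarrow> B * norm y \<le> norm (A_of A u *v y)"
    "\<And>u. dist u l < d \<Longrightarrow> u \<in> Y0 A"
proof -
  have "inj ((*v) (A_of A l))"
    using assms by (simp add: Y0_def invertible_det_nz inj_matrix_vector_mult)
  then obtain C where C: "C > 0" "\<And>y. C * norm y \<le> norm (A_of A l *v y)"
    using linear_inj_bounded_below_pos[OF matrix_vector_mul_linear] by metis
  obtain d where d: "d > 0"
    "\<And>u y. dist u l < d \<Longrightarrow> norm (A_of A u *v y - A_of A l *v y) \<le> C / 2 * norm y"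
    using A_of_perturbation[of "C / 2" l A] C(1) by auto
  have low: "C / 2 * norm y \<le> norm (A_of A u *v y)" if "dist u l < d" for u y
  proof -
    have "norm (A_of A l *v y) \<le> norm (A_of A u *v y) + norm (A_of A u *v y - A_of A l *v y)"
      by (metis norm_minus_commute norm_triangle_sub)
    then show ?thesis using C(2)[of y] d(2)[OF that, of y] by simp
  qed
  have nbhd: "u \<in> Y0 A" if "dist u l < d" for u
  proof -
    have "y = 0" if "A_of A u *v y = 0" for y
      using low[OF \<open>dist u l < d\<close>, of y] that C(1) by (simp add: mult_le_0_iff)
    then have "\<exists>B. B ** A_of A u = mat 1"
      by (simp add: matrix_left_invertible_ker)
    then show ?thesis
      unfolding Y0_def by (metis invertible_det_nz invertible_left_inverse mem_Collect_eq)
  qed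
  from C(1) have "C / 2 > 0" by simp
  then show thesis using d(1) low nbhd by (rule that)
qed

section \<open>Multiplier sets, orthants, and the Lagrangian as an affine function of the
  multiplier\<close>

lemma Yi_plus_subset_Y0: "Yi_plus A \<subseteq> Y0 A"
  by (auto simp: Yi_plus_def Y0_def pos_def_det_nonzero)

lemma Y0_subset_Ycol: "Y0 A \<subseteq> Ycol A b"
proof
  fix l assume "l \<in> Y0 A"
  then have "b_of b l = A_of A l *v (matrix_inv (A_of A l) *v b_of b l)"
    using Y0_solution_iff by metis
  then show "l \<in> Ycol A b"
    unfolding Ycol_def by blast
qed

lemma Yi_plus_subset_Ycol_i_plus: "Yi_plus A \<subseteq> Ycol_i_plus A b"
  using Yi_plus_subset_Y0[of A] Y0_subset_Ycol[of A b]
  unfolding Yi_plus_def Ycol_i_plus_def Ycol_i_def by (blast intro: pos_def_imp_pos_semidef)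

text \<open>This vector is the gradient of \<open>L\<close> in the multiplier, and it will turn out
  to be the gradient of \<open>D\<close> as well.\<close>

definition constraint_vec ::
  "('m::finite option \<Rightarrow> real^'n^'n) \<Rightarrow> ('m option \<Rightarrow> real^'n) \<Rightarrow> ('m option \<Rightarrow> real)
    \<Rightarrow> real^'n \<Rightarrow> real^'m" where
  "constraint_vec A b c x = (\<chi> j. quad A b c (Some j) x)"

lemma Lagr_inner: "Lagr A b c x u = quad A b c None x + u \<bullet> constraint_vec A b c x"
  by (simp add: Lagr_def constraint_vec_def inner_vec_def)

lemma GDERIV_Lagr_multiplier: "GDERIV (\<lambda>u. Lagr A b c x u) l :> constraint_vec A b c x"
  unfolding gderiv_def Lagr_inner by (auto intro!: derivative_eq_intros)

lemma mem_nonpos_orthant: "g \<in> nonpos_orthant \<longleftrightarrow> (\<forall>j. g $ j \<le> 0)"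
proof
  assume *: "\<forall>j. g $ j \<le> 0"
  have "g = - (- g)" by simp
  moreover have "- g \<in> nonneg_orthant" using * by (simp add: nonneg_orthant_def)
  ultimately show "g \<in> nonpos_orthant" unfolding nonpos_orthant_def by (rule image_eqI)
qed (auto simp: nonpos_orthant_def nonneg_orthant_def)

lemma orthant_inner_nonpos:
  assumes "u \<in> nonneg_orthant" and "g \<in> nonpos_orthant"
  shows "u \<bullet> g \<le> 0"
  using assms
  by (auto simp: mem_nonpos_orthant nonneg_orthant_def inner_vec_def
      intro!: sum_nonpos mult_nonneg_nonpos)

lemma constraint_vec_nonpos_iff:
  "constraint_vec A b c x \<in> nonpos_orthant \<longleftrightarrow> x \<in> feasible A b c"
  by (simp add: mem_nonpos_orthant constraint_vec_def feasible_def)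

lemma Lagr_le_objective:
  assumes "u \<in> nonneg_orthant" and "y \<in> feasible A b c"
  shows "Lagr A b c y u \<le> quad A b c None y"
  using orthant_inner_nonpos[OF assms(1)] assms(2)
  by (simp add: Lagr_inner constraint_vec_nonpos_iff)

section \<open>KKT points of the Lagrangian and weak duality for symmetric data\<close>

locale symmetric_data =
  fixes A :: "'m::finite option \<Rightarrow> real^'n^'n"
    and b :: "'m option \<Rightarrow> real^'n"
    and c :: "'m option \<Rightarrow> real"
  assumes symm: "\<And>k. transpose (A k) = A k"
begin

lemma A_of_swap: "(A_of A l *v x) \<bullet> y = x \<bullet> (A_of A l *v y)"
  by (rule symmetric_matrix_inner_swap[OF transpose_A_of[OF symm]])

lemma GDERIV_Lagr_primal: "GDERIV (\<lambda>y. Lagr A b c y l) x :> A_of A l *v x - b_of b l"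
  unfolding gderiv_def Lagr_eq
proof (rule has_derivative_eq_rhs)
  show "((\<lambda>y. 1/2 * (y \<bullet> (A_of A l *v y)) - y \<bullet> b_of b l + c_of c l) has_derivative
      (\<lambda>h. 1/2 * (x \<bullet> (A_of A l *v h) + h \<bullet> (A_of A l *v x)) - h \<bullet> b_of b l + 0)) (at x)"
    by (intro derivative_intros bounded_linear.has_derivative[OF matrix_vector_mul_bounded_linear])
  \<comment> \<open>Symmetry makes the two terms of the product rule equal, which cancels the factor
    1/2.\<close>
  have "x \<bullet> (A_of A l *v h) = h \<bullet> (A_of A l *v x)" for h
    by (metis A_of_swap inner_commute)
  then show "(\<lambda>h. 1/2 * (x \<bullet> (A_of A l *v h) + h \<bullet> (A_of A l *v x)) - h \<bullet> b_of b l + 0)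
      = (\<lambda>h. h \<bullet> (A_of A l *v x - b_of b l))"
    by (simp add: fun_eq_iff inner_diff_right)
qed

text \<open>Since gradients are unique, the derivative conditions can be evaluated once and for all;
  later arguments use this algebraic form.\<close>

lemma KKT_L_iff:
  "KKT_L A b c x l \<longleftrightarrow>
     A_of A l *v x = b_of b l \<and> l \<in> nonneg_orthant \<and> x \<in> feasible A b c
     \<and> l \<bullet> constraint_vec A b c x = 0"
proof -
  have "GDERIV (\<lambda>y. Lagr A b c y l) x :> 0 \<longleftrightarrow> A_of A l *v x = b_of b l"
    using GDERIV_Lagr_primal[of l x] GDERIV_unique by fastforce
  moreover have "GDERIV (\<lambda>u. Lagr A b c x u) l :> g \<longleftrightarrow> g = constraint_vec A b c x" for g
    using GDERIV_Lagr_multiplier GDERIV_unique by blast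
  ultimately show ?thesis
    by (simp add: KKT_L_def constraint_vec_nonpos_iff)
qed

lemma Lagr_complete_square:
  assumes "A_of A u *v z = b_of b u"
  shows "Lagr A b c y u = dual A b c u + 1/2 * ((y - z) \<bullet> (A_of A u *v (y - z)))"
proof -
  \<comment> \<open>By symmetry both cross terms of the expanded square are equal to the linear term
    of \<open>L\<close>.\<close>
  have "z \<bullet> (A_of A u *v y) = y \<bullet> b_of b u"
    using A_of_swap[of u z y] assms by (simp add: inner_commute)
  then show ?thesis
    using assms
    by (simp add: dual_eq[OF symm assms] Lagr_eq matrix_vector_mult_diff_distrib
        inner_diff_left inner_diff_right algebra_simps)
qed

lemma dual_le_Lagr:
  assumes "u \<in> Ycol_i_plus A b"
  shows "dual A b c u \<le> Lagr A b c y u"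
proof -
  obtain z where "A_of A u *v z = b_of b u"
    using assms by (auto simp: Ycol_i_plus_def Ycol_i_def Ycol_def)
  from Lagr_complete_square[OF this, of y] show ?thesis
    using assms by (simp add: Ycol_i_plus_def pos_semidef_def)
qed

text \<open>The chain is \<open>D(u) \<le> L(y,u) \<le> q0(y)\<close>: the first step drops a
  nonnegative square, the second a nonpositive penalty.\<close>

lemma weak_duality:
  assumes "u \<in> Ycol_i_plus A b" and "y \<in> feasible A b c"
  shows "dual A b c u \<le> quad A b c None y"
  using dual_le_Lagr[OF assms(1), of y] Lagr_le_objective[OF _ assms(2), of u] assms(1)
  by (auto simp: Ycol_i_plus_def Ycol_i_def)

section \<open>The gradient of the dual function\<close>

lemma GDERIV_dual:
  assumes l: "l \<in> Y0 A" and x: "A_of A l *v x = b_of b l"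
  shows "GDERIV (dual A b c) l :> constraint_vec A b c x"
proof -
  define K where "K = (\<Sum>k\<in>UNIV. norm (A k *v x - b k))"
  obtain B d where B: "B > 0" and d: "d > 0"
    and low: "\<And>u y. dist u l < d \<Longrightarrow> B * norm y \<le> norm (A_of A u *v y)"
    and nbhd: "\<And>u. dist u l < d \<Longrightarrow> u \<in> Y0 A"
    using Y0_neighbourhood[OF l] by metis
  let ?g = "constraint_vec A b c x"
  \<comment> \<open>The remainder is half an inner product of \<open>x - z\<close> and the residual
    \<open>r = A(u) (x - z)\<close>. The residual is at most \<open>K * norm (u - l)\<close>, and
    \<open>norm (x - z)\<close> is at most \<open>norm r / B\<close>, so the inverse matrix need not
    be differentiated.\<close>
  have bound: "\<bar>dual A b c u - dual A b c l - (u - l) \<bullet> ?g\<bar> \<le> K\<^sup>2 / B * (norm (u - l))\<^sup>2"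
    if u: "dist u l < d" for u
  proof -
    define z where "z = matrix_inv (A_of A u) *v b_of b u"
    have z: "A_of A u *v z = b_of b u"
      using Y0_solution_iff[OF nbhd[OF u]] by (simp add: z_def)
    let ?y = "x - z" and ?r = "A_of A u *v x - b_of b u"
    have r: "A_of A u *v ?y = ?r" by (simp add: matrix_vector_mult_diff_distrib z)
    have nr: "norm ?r \<le> norm (u - l) * K"
      using norm_residual_le[OF x] by (simp add: K_def)
    have ny: "norm ?y \<le> norm ?r / B"
      using low[OF u, of ?y] B by (simp add: r field_simps)
    \<comment> \<open>As \<open>D(l) = L(x,l)\<close> and \<open>L(x,_)\<close> is affine with slope
      \<open>?g\<close>, the left side is \<open>D(u) - L(x,u)\<close>, to which completing the
      square at \<open>z\<close> applies.\<close>
    have "dual A b c u - dual A b c l - (u - l) \<bullet> ?g = - (1/2 * (?y \<bullet> ?r))"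
      using Lagr_complete_square[OF z, of x] dual_eq[OF symm x, of c]
      by (simp add: Lagr_inner r inner_diff_left)
    then have "\<bar>dual A b c u - dual A b c l - (u - l) \<bullet> ?g\<bar> \<le> \<bar>?y \<bullet> ?r\<bar>"
      by simp
    also have "\<dots> \<le> norm ?y * norm ?r" by (rule Cauchy_Schwarz_ineq2)
    also have "\<dots> \<le> norm ?r / B * norm ?r" by (intro mult_right_mono ny) simp
    also have "\<dots> = (norm ?r)\<^sup>2 / B" by (simp add: power2_eq_square)
    also have "\<dots> \<le> (norm (u - l) * K)\<^sup>2 / B"
      using nr B by (intro divide_right_mono power_mono) auto
    finally show ?thesis by (simp add: power_mult_distrib mult.commute)
  qed
  show ?thesis
    unfolding gderiv_def
  \<comment> \<open>The quadratic bound makes the difference quotient at most a multiple of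
    \<open>norm (u - l)\<close>, which tends to 0.\<close>
  proof (rule has_derivativeI_sandwich[OF d])
    show "bounded_linear (\<lambda>h. h \<bullet> ?g)" by (rule bounded_linear_inner_left)
    fix u assume "u \<noteq> l" and "dist u l < d"
    then show "norm (dual A b c u - dual A b c l - (u - l) \<bullet> ?g) / norm (u - l)
        \<le> K\<^sup>2 / B * norm (u - l)"
      using bound[of u] by (simp add: divide_le_eq power2_eq_square mult.assoc)
  next
    have "((\<lambda>u. K\<^sup>2 / B * norm (u - l)) \<longlongrightarrow> K\<^sup>2 / B * norm (l - l)) (at l)"
      by (intro tendsto_intros)
    then show "((\<lambda>u. K\<^sup>2 / B * norm (u - l)) \<longlongrightarrow> 0) (at l)" by simp
  qed
qed

text \<open>The gradient of \<open>D\<close> at \<open>l\<close> and the multiplier gradient of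
  \<open>L\<close> at \<open>(x, l)\<close> are the same vector, so sign and complementarity
  conditions coincide.\<close>

lemma KKT_D_iff_KKT_L:
  assumes l: "l \<in> Y0 A" and x: "A_of A l *v x = b_of b l"
  shows "KKT_D A b c l \<longleftrightarrow> KKT_L A b c x l"
proof -
  have "GDERIV (dual A b c) l :> g \<longleftrightarrow> g = constraint_vec A b c x" for g
    using GDERIV_dual[OF assms] GDERIV_unique by blast
  then show ?thesis
    using assms by (simp add: KKT_D_def KKT_L_iff constraint_vec_nonpos_iff)
qed

section \<open>Optimality consequences of a KKT point of the Lagrangian\<close>

lemma KKT_L_values:
  assumes "KKT_L A b c x l"
  shows "Lagr A b c x l = quad A b c None x" and "dual A b c l = quad A b c None x"
proof -
  show "Lagr A b c x l = quad A b c None x"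
    using assms by (simp add: KKT_L_iff Lagr_inner)
  moreover have "dual A b c l = Lagr A b c x l"
    using assms by (intro dual_eq[OF symm]) (simp add: KKT_L_iff)
  ultimately show "dual A b c l = quad A b c None x" by simp
qed

text \<open>Weak duality bounds all feasible values below by \<open>D(l) = q0(x)\<close>, and the
  feasible point \<open>x\<close> attains the bound. In \<open>ereal\<close> the infimum is
  meaningful without a prior boundedness argument.\<close>

lemma KKT_L_INF:
  assumes "KKT_L A b c x l" and "l \<in> Ycol_i_plus A b"
  shows "(INF y\<in>feasible A b c. ereal (quad A b c None y)) = ereal (quad A b c None x)"
proof (rule antisym)
  show "(INF y\<in>feasible A b c. ereal (quad A b c None y)) \<le> ereal (quad A b c None x)"
    using assms(1) by (intro INF_lower) (simp add: KKT_L_iff)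
  show "ereal (quad A b c None x) \<le> (INF y\<in>feasible A b c. ereal (quad A b c None y))"
    using weak_duality[OF assms(2)] KKT_L_values[OF assms(1)] by (intro INF_greatest) simp
qed

text \<open>Dually, feasibility of \<open>x\<close> bounds all dual values above by
  \<open>q0(x)\<close>, and \<open>l\<close> attains this bound.\<close>

lemma KKT_L_SUP:
  assumes "KKT_L A b c x l" and "l \<in> Ycol_i_plus A b"
  shows "(SUP u\<in>Ycol_i_plus A b. ereal (dual A b c u)) = ereal (quad A b c None x)"
proof (rule antisym)
  show "(SUP u\<in>Ycol_i_plus A b. ereal (dual A b c u)) \<le> ereal (quad A b c None x)"
    using assms(1) by (intro SUP_least) (simp add: weak_duality KKT_L_iff)
  show "ereal (quad A b c None x) \<le> (SUP u\<in>Ycol_i_plus A b. ereal (dual A b c u))"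
    using SUP_upper[OF assms(2), of "\<lambda>u. ereal (dual A b c u)"]
    by (simp add: KKT_L_values[OF assms(1)])
qed

text \<open>Completing the square at \<open>x\<close> gives
  \<open>q0(y) \<ge> L(y,l) > D(l) = q0(x)\<close>, strict because the form is positive at
  \<open>y - x\<close>.\<close>

lemma KKT_L_strict_minimizer:
  assumes kkt: "KKT_L A b c x l" and l: "l \<in> Yi_plus A"
    and y: "y \<in> feasible A b c" "y \<noteq> x"
  shows "quad A b c None x < quad A b c None y"
proof -
  have "0 < (y - x) \<bullet> (A_of A l *v (y - x))"
    using l y by (simp add: Yi_plus_def pos_def_def)
  moreover have "Lagr A b c y l = dual A b c l + 1/2 * ((y - x) \<bullet> (A_of A l *v (y - x)))"
    using kkt by (intro Lagr_complete_square) (simp add: KKT_L_iff)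
  moreover have "Lagr A b c y l \<le> quad A b c None y"
    using l y by (intro Lagr_le_objective) (auto simp: Yi_plus_def)
  ultimately show ?thesis using KKT_L_values[OF kkt] by simp
qed

section \<open>First-order conditions for maximizers of the dual function\<close>

lemma pos_def_neighbourhood:
  assumes "pos_def (A_of A l)"
  obtains d where "d > 0" and "\<And>u. dist u l < d \<Longrightarrow> pos_def (A_of A u)"
proof -
  obtain e where e: "e > 0" "\<And>y. e * (norm y)\<^sup>2 \<le> y \<bullet> (A_of A l *v y)"
    using pos_def_bounded_below[OF assms] by metis
  obtain d where d: "d > 0"
    "\<And>u y. dist u l < d \<Longrightarrow> norm (A_of A u *v y - A_of A l *v y) \<le> e / 2 * norm y"
    using A_of_perturbation[of "e / 2" l A] e(1) by auto
  \<comment> \<open>The form at \<open>l\<close> is at least \<open>e * (norm y)\<^sup>2\<close>,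
    and passing to \<open>u\<close> changes it by at most half of that.\<close>
  have "0 < y \<bullet> (A_of A u *v y)" if u: "dist u l < d" and y: "y \<noteq> 0" for u y
  proof -
    let ?w = "A_of A u *v y - A_of A l *v y"
    have "\<bar>y \<bullet> ?w\<bar> \<le> norm y * norm ?w" by (rule Cauchy_Schwarz_ineq2)
    also have "\<dots> \<le> norm y * (e / 2 * norm y)" by (intro mult_left_mono d u) simp
    also have "\<dots> < e * (norm y)\<^sup>2" using e(1) y by (simp add: power2_eq_square)
    also have "\<dots> \<le> y \<bullet> (A_of A l *v y)" by (rule e)
    finally show ?thesis by (simp add: inner_diff_right)
  qed
  then show thesis
    using that[OF d(1)] by (simp add: pos_def_def transpose_A_of[OF symm])
qed

text \<open>A positive slope along \<open>v\<close> would make short steps increase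
  \<open>D\<close>, while openness of positive definiteness keeps them in \<open>Yi_plus A\<close>.
  Admissibility is asked only for steps up to 1, so that \<open>v = - l\<close> qualifies.\<close>

lemma maximizer_directional_derivative:
  assumes l: "l \<in> Yi_plus A" and max: "\<And>u. u \<in> Yi_plus A \<Longrightarrow> dual A b c u \<le> dual A b c l"
    and g: "GDERIV (dual A b c) l :> g"
    and v: "\<And>t. 0 < t \<Longrightarrow> t \<le> 1 \<Longrightarrow> l + t *\<^sub>R v \<in> nonneg_orthant"
  shows "v \<bullet> g \<le> 0"
proof (rule ccontr)
  assume "\<not> v \<bullet> g \<le> 0"
  then have pos: "0 < v \<bullet> g" by simp
  have "((\<lambda>t. dual A b c (l + t *\<^sub>R v)) has_derivative (\<lambda>t. (t *\<^sub>R v) \<bullet> g)) (at 0)"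
    using g unfolding gderiv_def
    by (intro has_derivative_compose[of "\<lambda>t. l + t *\<^sub>R v" _ 0 UNIV "dual A b c" "\<lambda>h. h \<bullet> g"])
       (auto intro!: derivative_eq_intros)
  then have "((\<lambda>t. dual A b c (l + t *\<^sub>R v)) has_real_derivative v \<bullet> g) (at 0)"
    by (simp add: has_field_derivative_def mult_commute_abs)
  from has_real_derivative_pos_inc_right[OF this pos] obtain e where e: "e > 0"
    "\<And>h. 0 < h \<Longrightarrow> h < e \<Longrightarrow> dual A b c l < dual A b c (l + h *\<^sub>R v)"
    by auto
  obtain d where d: "d > 0" "\<And>u. dist u l < d \<Longrightarrow> pos_def (A_of A u)"
    using pos_def_neighbourhood l by (auto simp: Yi_plus_def)
  have "v \<noteq> 0" using pos by auto
  \<comment> \<open>The three terms keep the step admissible, inside the interval of increase, and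
    within distance \<open>d\<close>; the factors 2 make the last two bounds strict.\<close>
  define h where "h = min (min 1 (e / 2)) (d / (2 * norm v))"
  have h: "0 < h" "h \<le> 1" "h < e" "h \<le> d / (2 * norm v)"
    using d(1) e(1) \<open>v \<noteq> 0\<close> by (auto simp: h_def)
  then have "h * norm v < d"
    using d(1) \<open>v \<noteq> 0\<close> by (simp add: field_simps)
  then have "dist (l + h *\<^sub>R v) l < d"
    using h(1) by (simp add: dist_norm)
  then have "l + h *\<^sub>R v \<in> Yi_plus A"
    using d(2) v[OF h(1,2)] by (simp add: Yi_plus_def)
  from max[OF this] e(2)[OF h(1,3)] show False by simp
qed

lemma maximizer_KKT_D:
  assumes l: "l \<in> Yi_plus A" and max: "\<And>u. u \<in> Yi_plus A \<Longrightarrow> dual A b c u \<le> dual A b c l"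
  shows "KKT_D A b c l"
proof -
  have l0: "l \<in> Y0 A" and ln: "\<And>j. 0 \<le> l $ j" "l \<in> nonneg_orthant"
    using l Yi_plus_subset_Y0 by (auto simp: Yi_plus_def nonneg_orthant_def)
  define g where "g = constraint_vec A b c (matrix_inv (A_of A l) *v b_of b l)"
  have g: "GDERIV (dual A b c) l :> g"
    unfolding g_def by (rule GDERIV_dual[OF l0]) (simp add: Y0_solution_iff[OF l0])
  note dir = maximizer_directional_derivative[OF l max g]
  \<comment> \<open>Moving along a coordinate axis stays in the nonnegative orthant.\<close>
  have "g $ j \<le> 0" for j
    using dir[of "axis j 1"] ln
    by (simp add: nonneg_orthant_def axis_def inner_axis' [unfolded axis_def])
  moreover have "l \<bullet> g \<le> 0"
    using dir[of l] ln by (simp add: nonneg_orthant_def)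
  \<comment> \<open>The point \<open>l + t (- l) = (1 - t) l\<close> stays nonnegative for
    \<open>t \<le> 1\<close>. Together with direction \<open>l\<close> this gives complementary
    slackness.\<close>
  moreover have "- l \<bullet> g \<le> 0"
    using dir[of "- l"] ln by (simp add: nonneg_orthant_def mult_left_le_one_le)
  ultimately have "g \<in> nonpos_orthant" and "l \<bullet> g = 0"
    by (simp_all add: mem_nonpos_orthant)
  then show ?thesis
    using l0 ln(2) g unfolding KKT_D_def by blast
qed

text \<open>The implications form a cycle: maximal on the larger set, maximal on the smaller set,
  KKT point of \<open>D\<close>, and back to the larger set by strong duality.\<close>

lemma dual_maximizer_equivalences:
  assumes l: "l \<in> Yi_plus A"
  shows "ereal (dual A b c l) = (SUP u\<in>Ycol_i_plus A b. ereal (dual A b c u)) \<longleftrightarrow> KKT_D A b c l"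
    and "ereal (dual A b c l) = (SUP u\<in>Yi_plus A. ereal (dual A b c u)) \<longleftrightarrow> KKT_D A b c l"
proof -
  let ?D = "\<lambda>u. ereal (dual A b c u)"
  let ?S = "SUP u\<in>Ycol_i_plus A b. ?D u" and ?T = "SUP u\<in>Yi_plus A. ?D u"
  have le: "?D l \<le> ?T" "?T \<le> ?S"
    using l Yi_plus_subset_Ycol_i_plus by (auto intro: SUP_upper SUP_subset_mono)
  have KS: "?D l = ?S" if "KKT_D A b c l"
  proof -
    have l0: "l \<in> Y0 A" "l \<in> Ycol_i_plus A b"
      using l Yi_plus_subset_Y0 Yi_plus_subset_Ycol_i_plus by blast+
    then obtain x where "A_of A l *v x = b_of b l"
      using Y0_solution_iff by blast
    with that l0 have kkt: "KKT_L A b c x l" using KKT_D_iff_KKT_L by blast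
    show ?thesis using KKT_L_SUP[OF kkt l0(2)] KKT_L_values(2)[OF kkt] by simp
  qed
  have TK: "KKT_D A b c l" if "?D l = ?T"
  proof (rule maximizer_KKT_D[OF l])
    fix u assume "u \<in> Yi_plus A"
    then have "?D u \<le> ?D l" unfolding that by (rule SUP_upper)
    then show "dual A b c u \<le> dual A b c l" by simp
  qed
  \<comment> \<open>The supremum over the smaller set is squeezed between \<open>D(l)\<close> and
    the supremum over the larger one.\<close>
  have ST: "?D l = ?T" if "?D l = ?S"
    using le(1) le(2)[folded that] by (rule order.antisym)
  show "?D l = ?S \<longleftrightarrow> KKT_D A b c l"
    by (rule iffI[OF TK[OF ST] KS])
  show "?D l = ?T \<longleftrightarrow> KKT_D A b c l"
    by (rule iffI[OF TK ST[OF KS]])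
qed

end

section \<open>Claims (i), (ii) and (iii)\<close>

theorem proposition13:
  fixes A :: "'m::finite option \<Rightarrow> real^'n^'n"
    and b :: "'m option \<Rightarrow> real^'n"
    and c :: "'m option \<Rightarrow> real"
    and x :: "real^'n" and l :: "real^'m"
  assumes symm: "\<And>k. transpose (A k) = A k"
  shows
    "(KKT_L A b c x l \<longrightarrow>
        KKT_P A b c x \<and> x \<in> feasible A b c \<and> l \<in> Ycol_i A b \<and>
        quad A b c None x = Lagr A b c x l \<and> Lagr A b c x l = dual A b c l \<and>
        (l \<in> Ycol_i_plus A b \<longrightarrow>
           ereal (quad A b c None x) = (INF y\<in>feasible A b c. ereal (quad A b c None y)) \<and>
           (INF y\<in>feasible A b c. ereal (quad A b c None y)) = ereal (Lagr A b c x l) \<and>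
           ereal (Lagr A b c x l) = (SUP u\<in>Ycol_i_plus A b. ereal (dual A b c u)) \<and>
           (SUP u\<in>Ycol_i_plus A b. ereal (dual A b c u)) = ereal (dual A b c l)))
     \<and>
     (KKT_L A b c x l \<and> l \<in> Y0 A \<longrightarrow>
        x = matrix_inv (A_of A l) *v b_of b l \<and> KKT_D A b c l \<and>
        (l \<in> Yi_plus A \<longrightarrow>
           is_arg_min (quad A b c None) (\<lambda>y. y \<in> feasible A b c) x \<and>
           (\<forall>y. is_arg_min (quad A b c None) (\<lambda>z. z \<in> feasible A b c) y \<longrightarrow> y = x)))
     \<and>
     (l \<in> Y0 A \<and> KKT_D A b c l \<longrightarrow>
        KKT_L A b c (matrix_inv (A_of A l) *v b_of b l) l)
     \<and>
     (l \<in> Yi_plus A \<longrightarrow>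
        (ereal (dual A b c l) = (SUP u\<in>Ycol_i_plus A b. ereal (dual A b c u)) \<longleftrightarrow>
         ereal (dual A b c l) = (SUP u\<in>Yi_plus A. ereal (dual A b c u))) \<and>
        (ereal (dual A b c l) = (SUP u\<in>Yi_plus A. ereal (dual A b c u)) \<longleftrightarrow>
         KKT_D A b c l))"
\<comment> \<open>Only conjunctions with an implication on the left are split, which leaves four
  goals: (i), the two directions of (ii), and (iii).\<close>
proof (intro conjI[of "_ \<longrightarrow> _"] impI)
  interpret symmetric_data A b c by unfold_locales (rule symm)
  {
    assume kkt: "KKT_L A b c x l"
    have "KKT_P A b c x"
      using kkt unfolding KKT_P_def by blast
    moreover have "x \<in> feasible A b c" "l \<in> Ycol_i A b"
      using kkt by (auto simp: KKT_L_iff Ycol_i_def Ycol_def image_iff intro: sym)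
    ultimately show "KKT_P A b c x \<and> x \<in> feasible A b c \<and> l \<in> Ycol_i A b \<and>
        quad A b c None x = Lagr A b c x l \<and> Lagr A b c x l = dual A b c l \<and>
        (l \<in> Ycol_i_plus A b \<longrightarrow>
           ereal (quad A b c None x) = (INF y\<in>feasible A b c. ereal (quad A b c None y)) \<and>
           (INF y\<in>feasible A b c. ereal (quad A b c None y)) = ereal (Lagr A b c x l) \<and>
           ereal (Lagr A b c x l) = (SUP u\<in>Ycol_i_plus A b. ereal (dual A b c u)) \<and>
           (SUP u\<in>Ycol_i_plus A b. ereal (dual A b c u)) = ereal (dual A b c l))"
      using KKT_L_values[OF kkt] KKT_L_INF[OF kkt] KKT_L_SUP[OF kkt] by simp
  }
  {
    assume "KKT_L A b c x l \<and> l \<in> Y0 A"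
    then have kkt: "KKT_L A b c x l" and l0: "l \<in> Y0 A" by auto
    then have x: "A_of A l *v x = b_of b l" and feas: "x \<in> feasible A b c"
      by (auto simp: KKT_L_iff)
    have "x = matrix_inv (A_of A l) *v b_of b l"
      using x Y0_solution_iff[OF l0] by blast
    moreover have "KKT_D A b c l"
      using kkt KKT_D_iff_KKT_L[OF l0 x] by blast
    \<comment> \<open>Every other feasible point has a strictly larger value, which gives both
      minimality and uniqueness.\<close>
    moreover have "is_arg_min (quad A b c None) (\<lambda>y. y \<in> feasible A b c) x \<and>
           (\<forall>y. is_arg_min (quad A b c None) (\<lambda>z. z \<in> feasible A b c) y \<longrightarrow> y = x)"
      if "l \<in> Yi_plus A"
      using KKT_L_strict_minimizer[OF kkt that] feas unfolding is_arg_min_def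
      by (metis less_asym less_irrefl)
    ultimately show "x = matrix_inv (A_of A l) *v b_of b l \<and> KKT_D A b c l \<and>
        (l \<in> Yi_plus A \<longrightarrow>
           is_arg_min (quad A b c None) (\<lambda>y. y \<in> feasible A b c) x \<and>
           (\<forall>y. is_arg_min (quad A b c None) (\<lambda>z. z \<in> feasible A b c) y \<longrightarrow> y = x))"
      by blast
  }
  {
    assume "l \<in> Y0 A \<and> KKT_D A b c l"
    then show "KKT_L A b c (matrix_inv (A_of A l) *v b_of b l) l"
      using KKT_D_iff_KKT_L Y0_solution_iff by blast
  }
  {
    assume "l \<in> Yi_plus A"
    from dual_maximizer_equivalences[OF this]
    show "(ereal (dual A b c l) = (SUP u\<in>Ycol_i_plus A b. ereal (dual A b c u)) \<longleftrightarrow>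
         ereal (dual A b c l) = (SUP u\<in>Yi_plus A. ereal (dual A b c u))) \<and>
        (ereal (dual A b c l) = (SUP u\<in>Yi_plus A. ereal (dual A b c u)) \<longleftrightarrow>
         KKT_D A b c l)"
      by blast
  }
qed

end
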